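(* Let $p$ be a prime, let $m>n\ge 0$ be integers, and let $\chi_1,\dots,\chi_k$ be multiplicative characters mod $p^m$ with $\chi_k$ primitive mod $p^m$. Let $$J_{p^n}(\chi_1,\dots,\chi_k,p^m)=\sum_{x_1=1}^{p^m}\cdots\sum_{\substack{x_k=1\\ x_1+\cdots+x_k\equiv p^n\bmod p^m}}^{p^m}\chi_1(x_1)\cdots\chi_k(x_k).$$ If $\chi_1\cdots\chi_k$ is a mod $p^{m-n}$ character, then $$J_{p^n}(\chi_1,\dots,\chi_k,p^m)=p^n\,\frac{\overline{G(\chi_1\cdots\chi_k,p^{m-n})}}{\overline{G(\chi_k,p^m)}}\prod_{i=1}^{k-1}G(\chi_i,p^m).$$ If $\chi_1\cdots\chi_k$ is not a mod $p^{m-n}$ character, then $J_{p^n}(\chi_1,\dots,\chi_k,p^m)=0$.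
   Context: A character mod $q$ is a multiplicative (Dirichlet) character, with $\chi(x)=0$ when $\gcd(x,q)>1$. For a character $\chi$ mod $p^j$, the Gauss sum is $G(\chi,p^j):=\sum_{x=1}^{p^j}\chi(x)e_{p^j}(x)$, where $e_y(x):=e^{2\pi i x/y}$. Saying that $\chi_1\cdots\chi_k$ "is a mod $p^{m-n}$ character" means that this character mod $p^m$ is induced by a (not necessarily primitive) character mod $p^{m-n}$, with which it is identified in $G(\chi_1\cdots\chi_k,p^{m-n})$. The overline denotes complex conjugation. *)

theory Defs
  imports Complex_Main "HOL-Number_Theory.Cong" "HOL-Library.FuncSet"
begin

text \<open>
  Characters mod \<open>q\<close> are represented as \<open>q\<close>-periodic functions on all of the integers,
  extended by zero to the arguments not coprime to \<open>q\<close>.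
\<close>

definition dirichlet_char :: "nat \<Rightarrow> (int \<Rightarrow> complex) \<Rightarrow> bool" where
  "dirichlet_char q \<chi> \<longleftrightarrow>
     q > 0 \<and>
     (\<forall>x y. [x = y] (mod int q) \<longrightarrow> \<chi> x = \<chi> y) \<and>
     (\<forall>x y. \<chi> (x * y) = \<chi> x * \<chi> y) \<and>
     (\<forall>x. \<chi> x = 0 \<longleftrightarrow> \<not> coprime x (int q))"

definition induced_by :: "nat \<Rightarrow> (int \<Rightarrow> complex) \<Rightarrow> nat \<Rightarrow> (int \<Rightarrow> complex) \<Rightarrow> bool" where
  "induced_by q \<chi> d \<psi> \<longleftrightarrow>
     d dvd q \<and> dirichlet_char q \<chi> \<and> dirichlet_char d \<psi> \<and>
     (\<forall>x. coprime x (int q) \<longrightarrow> \<chi> x = \<psi> x)"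

definition primitive_char :: "nat \<Rightarrow> (int \<Rightarrow> complex) \<Rightarrow> bool" where
  "primitive_char q \<chi> \<longleftrightarrow>
     dirichlet_char q \<chi> \<and> \<not> (\<exists>d \<psi>. d < q \<and> induced_by q \<chi> d \<psi>)"

definition e_mod :: "nat \<Rightarrow> int \<Rightarrow> complex" where
  "e_mod y x = exp (2 * of_real pi * \<i> * of_int x / of_nat y)"

definition gauss_sum :: "(int \<Rightarrow> complex) \<Rightarrow> nat \<Rightarrow> complex" where
  "gauss_sum \<chi> q = (\<Sum>x = 1..int q. \<chi> x * e_mod q x)"

definition char_prod :: "(nat \<Rightarrow> int \<Rightarrow> complex) \<Rightarrow> nat \<Rightarrow> int \<Rightarrow> complex" where
  "char_prod \<chi> k x = (\<Prod>i = 1..k. \<chi> i x)"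

text \<open>The tuples \<open>(x\<^sub>1, \<dots>, x\<^sub>k)\<close> are the extensional functions on \<open>{1..k}\<close>.\<close>

definition jacobi_sum :: "int \<Rightarrow> (nat \<Rightarrow> int \<Rightarrow> complex) \<Rightarrow> nat \<Rightarrow> nat \<Rightarrow> complex" where
  "jacobi_sum B \<chi> k q =
     (\<Sum>x \<in> {x \<in> {1..k} \<rightarrow>\<^sub>E {1..int q}. [(\<Sum>i = 1..k. x i) = B] (mod int q)}.
        \<Prod>i = 1..k. \<chi> i (x i))"

end

theory Submission
  imports Defs "HOL-Number_Theory.Residues"
begin

text \<open>
  Put \<open>q = p\<^sup>m\<close>, \<open>e(x) = e_mod q x\<close>, and let \<open>\<chi> = \<chi>\<^sub>1 \<cdots> \<chi>\<^sub>k\<close>. Detecting the condition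
  \<open>x\<^sub>1 + \<cdots> + x\<^sub>k \<equiv> B\<close> by the additive characters mod \<open>q\<close> decouples the variables: \<open>q\<close> times the
  Jacobi sum is the sum over \<open>t\<close> mod \<open>q\<close> of \<open>e(-t B)\<close> times the product of the \<open>k\<close> twisted
  Gauss sums \<open>\<Sum>x. \<chi>\<^sub>i(x) e(t x)\<close> (\<open>jacobi_sum_fourier\<close>).

  For \<open>t\<close> prime to \<open>p\<close> the substitution \<open>x \<mapsto> x / t\<close> turns the \<open>i\<close>-th twisted sum into the conjugate
  of \<open>\<chi>\<^sub>i(t)\<close> times \<open>G(\<chi>\<^sub>i)\<close>. For \<open>t\<close> divisible by \<open>p\<close> this may fail for \<open>i < k\<close>, but the
  primitive character \<open>\<chi>\<^sub>k\<close> makes the last factor vanish, and with it the product. So for every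
  \<open>t\<close> the product equals the conjugate of \<open>\<chi>(t)\<close> times \<open>\<Prod>i. G(\<chi>\<^sub>i)\<close>, and the Jacobi sum is
  \<open>(1/q) \<Prod>i. G(\<chi>\<^sub>i)\<close> times the conjugate of \<open>S = \<Sum>t. \<chi>(t) e(t B)\<close>. Since \<open>\<chi>\<^sub>k\<close> is primitive,
  \<open>\<bar>G(\<chi>\<^sub>k)\<bar>\<^sup>2 = q\<close>, which trades \<open>G(\<chi>\<^sub>k) / q\<close> for the reciprocal of the conjugate of \<open>G(\<chi>\<^sub>k)\<close>
  (\<open>jacobi_sum_eq_gauss_sums\<close>).

  For \<open>B = p\<^sup>n\<close> the factor \<open>e(t B)\<close> has period \<open>d = p\<^sup>m\<^sup>-\<^sup>n\<close> in \<open>t\<close>. If \<open>\<chi>\<close> is induced from mod \<open>d\<close>, the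
  whole summand of \<open>S\<close> has period \<open>d\<close> and \<open>S\<close> is \<open>p\<^sup>n\<close> copies of the Gauss sum mod \<open>d\<close>. Otherwise
  some unit \<open>u \<equiv> 1\<close> mod \<open>d\<close> has \<open>\<chi>(u) \<noteq> 1\<close>, and \<open>t \<mapsto> u t\<close> gives \<open>S = \<chi>(u) S\<close>, so \<open>S = 0\<close>
  (\<open>not_induced_by_prime_power_witness\<close>, \<open>sum_dirichlet_char_periodic_eq_0\<close>). The same
  argument with \<open>d = p\<^sup>m\<^sup>-\<^sup>1\<close> is what makes the twisted Gauss sum of \<open>\<chi>\<^sub>k\<close> vanish at multiples of \<open>p\<close>.
\<close>

section \<open>Sums over a complete system of residues\<close>

text \<open>
  Such a map \<open>g\<close>, reduced into \<open>{1..q}\<close>, is injective on this finite set and hence permutes it.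
  Both the translations and the multiplications by units used below are of this kind.
\<close>

lemma sum_residues_reindex:
  fixes f :: "int \<Rightarrow> 'a::comm_monoid_add"
  assumes q: "q > 0"
    and f: "\<And>x y. [x = y] (mod int q) \<Longrightarrow> f x = f y"
    and g: "\<And>x y. [g x = g y] (mod int q) \<Longrightarrow> [x = y] (mod int q)"
  shows "(\<Sum>x = 1..int q. f (g x)) = (\<Sum>x = 1..int q. f x)"
proof -
  \<comment> \<open>The representatives run over \<open>{1..q}\<close> rather than \<open>{0..<q}\<close>, hence the shift by one.\<close>
  define h where "h x = (g x - 1) mod int q + 1" for x
  have h_cong: "[h x = g x] (mod int q)" for x
    by (simp add: h_def cong_def mod_simps)
  have "h x \<in> {1..int q}" for x
    using q pos_mod_bound[of "int q" "g x - 1"] by (simp add: h_def del: pos_mod_bound)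
  then have "h ` {1..int q} \<subseteq> {1..int q}"
    by blast
  moreover have "inj_on h {1..int q}"
  proof (rule inj_onI)
    fix x y assume xy: "x \<in> {1..int q}" "y \<in> {1..int q}" "h x = h y"
    then have "[g x = g y] (mod int q)"
      using h_cong[of x] h_cong[of y] by (simp add: cong_def)
    then have "[x = y] (mod int q)"
      by (rule g)
    then have "[x - 1 = y - 1] (mod int q)"
      by (simp add: cong_diff)
    then show "x = y"
      using cong_less_imp_eq_int[of "x - 1" "int q" "y - 1"] xy by simp
  qed
  ultimately have "bij_betw h {1..int q} {1..int q}"
    by (simp add: bij_betw_def endo_inj_surj)
  then have "(\<Sum>x = 1..int q. f (h x)) = (\<Sum>x = 1..int q. f x)"
    by (rule sum.reindex_bij_betw)
  then show ?thesis
    using f[OF h_cong] by simp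
qed

lemma sum_residues_mult:
  fixes f :: "int \<Rightarrow> 'a::comm_monoid_add"
  assumes "q > 0" "coprime u (int q)"
    and "\<And>x y. [x = y] (mod int q) \<Longrightarrow> f x = f y"
  shows "(\<Sum>x = 1..int q. f (u * x)) = (\<Sum>x = 1..int q. f x)"
  using assms by (intro sum_residues_reindex) (auto simp: cong_mult_lcancel)

lemma sum_residues_multiple:
  fixes f :: "int \<Rightarrow> complex"
  assumes d: "d > 0"
    and f: "\<And>x y. [x = y] (mod int d) \<Longrightarrow> f x = f y"
  shows "(\<Sum>x = 1..int (c * d). f x) = of_nat c * (\<Sum>x = 1..int d. f x)"
proof (induction c)
  case (Suc c)
  have "{1..int (Suc c * d)} = {1..int (c * d)} \<union> {int (c * d) + 1..int (c * d) + int d}"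
  proof -
    have "0 \<le> int (c * d)"
      by simp
    then show ?thesis
      unfolding mult_Suc of_nat_add by (auto simp del: of_nat_mult of_nat_0_le_iff)
  qed
  then have "(\<Sum>x = 1..int (Suc c * d). f x) =
      (\<Sum>x = 1..int (c * d). f x) + (\<Sum>x = int (c * d) + 1..int (c * d) + int d. f x)"
    by (simp add: sum.union_disjoint)
  also have "(\<Sum>x = int (c * d) + 1..int (c * d) + int d. f x) = (\<Sum>x = 1..int d. f (x + int (c * d)))"
    by (rule sum.reindex_bij_witness[of _ "\<lambda>x. x + int (c * d)" "\<lambda>x. x - int (c * d)"]) auto
  also have "\<dots> = (\<Sum>x = 1..int d. f x)"
    by (intro sum.cong refl f) (simp add: cong_def)
  finally show ?case
    using Suc.IH by (simp add: algebra_simps)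
qed simp

section \<open>Additive characters\<close>

lemma e_mod_add: "e_mod q (x + y) = e_mod q x * e_mod q y"
  by (simp add: e_mod_def exp_add [symmetric] add_divide_distrib distrib_left)

lemma e_mod_sum: "e_mod q (\<Sum>i\<in>A. f i) = (\<Prod>i\<in>A. e_mod q (f i))"
  by (induction A rule: infinite_finite_induct) (simp_all add: e_mod_add, simp_all add: e_mod_def)

lemma e_mod_eq_cis: "e_mod q x = cis (2 * pi * real_of_int x / real q)"
  by (simp add: e_mod_def cis_conv_exp mult_ac)

lemma cnj_e_mod: "cnj (e_mod q x) = e_mod q (- x)"
  by (simp add: e_mod_eq_cis cis_cnj)

lemma e_mod_eq_1_iff:
  assumes "q > 0"
  shows "e_mod q x = 1 \<longleftrightarrow> int q dvd x"
proof -
  have "e_mod q x = 1 \<longleftrightarrow> cos (2 * pi * real_of_int x / real q) = 1"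
    by (auto simp: e_mod_eq_cis complex_eq_iff cos_one_sin_zero)
  also have "\<dots> \<longleftrightarrow> (\<exists>n::int. 2 * pi * real_of_int x / real q = of_int n * 2 * pi)"
    by (rule cos_one_2pi_int)
  also have "\<dots> \<longleftrightarrow> (\<exists>n::int. real_of_int x = real_of_int (int q * n))"
    using assms by (intro ex_cong1) (auto simp: field_simps)
  also have "\<dots> \<longleftrightarrow> int q dvd x"
    by (simp only: of_int_eq_iff dvd_def)
  finally show ?thesis .
qed

lemma e_mod_cong:
  assumes "q > 0" "[x = y] (mod int q)"
  shows "e_mod q x = e_mod q y"
proof -
  have "e_mod q (x - y) = 1"
    using assms by (simp add: e_mod_eq_1_iff cong_iff_dvd_diff)
  then show ?thesis
    using e_mod_add[of q "x - y" y] by simp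
qed

lemma e_mod_mult_cancel:
  assumes "c > 0"
  shows "e_mod (c * d) (int c * x) = e_mod d x"
  using assms by (simp add: e_mod_eq_cis mult_ac)

text \<open>
  Orthogonality of additive characters: the shift \<open>t \<mapsto> 1 + t\<close> multiplies the sum by
  \<open>e_mod q a\<close>, which differs from 1 unless \<open>q\<close> divides \<open>a\<close>.
\<close>

lemma sum_e_mod:
  assumes q: "q > 0"
  shows "(\<Sum>t = 1..int q. e_mod q (t * a)) = (if int q dvd a then of_nat q else 0)"
proof (cases "int q dvd a")
  case True
  then have "e_mod q (t * a) = 1" for t
    using q by (simp add: e_mod_eq_1_iff)
  with True show ?thesis by simp
next
  case False
  let ?S = "\<Sum>t = 1..int q. e_mod q (t * a)"
  have "?S = (\<Sum>t = 1..int q. e_mod q ((1 + t) * a))"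
    by (rule sum_residues_reindex[symmetric])
      (auto intro!: e_mod_cong cong_scalar_right simp: q cong_add_lcancel)
  also have "\<dots> = e_mod q a * ?S"
    by (simp add: distrib_right e_mod_add sum_distrib_left)
  finally have "(1 - e_mod q a) * ?S = 0"
    by (simp add: algebra_simps)
  then show ?thesis
    using False q by (simp add: e_mod_eq_1_iff)
qed

section \<open>Multiplicative characters\<close>

lemma
  assumes "dirichlet_char q \<chi>"
  shows dirichlet_char_pos: "q > 0"
    and dirichlet_char_cong: "[x = y] (mod int q) \<Longrightarrow> \<chi> x = \<chi> y"
    and dirichlet_char_mult: "\<chi> (x * y) = \<chi> x * \<chi> y"
    and dirichlet_char_eq_0_iff: "\<chi> x = 0 \<longleftrightarrow> \<not> coprime x (int q)"
  using assms unfolding dirichlet_char_def by blast+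

lemma dirichlet_char_1:
  assumes "dirichlet_char q \<chi>"
  shows "\<chi> 1 = 1"
  using dirichlet_char_mult[OF assms, of 1 1] dirichlet_char_eq_0_iff[OF assms, of 1] by simp

lemma dirichlet_char_power:
  assumes "dirichlet_char q \<chi>"
  shows "\<chi> (x ^ n) = \<chi> x ^ n"
  by (induction n) (simp_all add: dirichlet_char_1[OF assms] dirichlet_char_mult[OF assms])

lemma dirichlet_char_char_prod:
  assumes "k \<ge> 1" "\<And>i. i \<in> {1..k} \<Longrightarrow> dirichlet_char q (\<chi> i)"
  shows "dirichlet_char q (char_prod \<chi> k)"
  unfolding dirichlet_char_def
proof (intro conjI allI impI)
  show "q > 0"
    using assms dirichlet_char_pos[of q "\<chi> 1"] by simp
next
  fix x y :: int assume "[x = y] (mod int q)"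
  then show "char_prod \<chi> k x = char_prod \<chi> k y"
    unfolding char_prod_def by (intro prod.cong refl dirichlet_char_cong[OF assms(2)])
next
  fix x y :: int
  show "char_prod \<chi> k (x * y) = char_prod \<chi> k x * char_prod \<chi> k y"
    unfolding char_prod_def prod.distrib[symmetric]
    by (intro prod.cong refl dirichlet_char_mult[OF assms(2)])
next
  fix x :: int
  have "char_prod \<chi> k x = 0 \<longleftrightarrow> (\<exists>i\<in>{1..k}. \<chi> i x = 0)"
    by (simp add: char_prod_def)
  also have "\<dots> \<longleftrightarrow> (\<exists>i\<in>{1..k}. \<not> coprime x (int q))"
    by (intro bex_cong refl dirichlet_char_eq_0_iff[OF assms(2)])
  finally show "char_prod \<chi> k x = 0 \<longleftrightarrow> \<not> coprime x (int q)"
    using assms(1) by auto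
qed

text \<open>By Euler's theorem the value at a unit is a root of unity, so it has modulus 1.\<close>

lemma dirichlet_char_mult_cnj:
  assumes \<chi>: "dirichlet_char q \<chi>" and x: "coprime x (int q)"
  shows "\<chi> x * cnj (\<chi> x) = 1"
proof -
  have q: "q > 0"
    by (rule dirichlet_char_pos[OF \<chi>])
  define a where "a = nat (x mod int q)"
  have a: "int a = x mod int q"
    using q by (simp add: a_def)
  have "coprime (int a) (int q)"
    using x q unfolding a by (simp add: coprime_commute)
  then have "[a ^ totient q = 1] (mod q)"
    by (intro euler_theorem) simp
  then have "[int a ^ totient q = 1] (mod int q)"
    by (metis cong_int_iff of_nat_1 of_nat_power)
  then have "\<chi> (int a ^ totient q) = \<chi> 1"
    by (rule dirichlet_char_cong[OF \<chi>])
  then have "\<chi> (int a) ^ totient q = 1"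
    by (simp add: dirichlet_char_power[OF \<chi>] dirichlet_char_1[OF \<chi>])
  moreover have "\<chi> (int a) = \<chi> x"
    by (rule dirichlet_char_cong[OF \<chi>]) (simp add: a cong_def)
  ultimately have "norm (\<chi> x) ^ totient q = 1"
    by (simp flip: norm_power)
  then have "norm (\<chi> x) = 1"
    using q by (intro power_eq_imp_eq_base[of _ "totient q" 1]) simp_all
  then show ?thesis
    by (simp add: complex_norm_square [symmetric])
qed

text \<open>
  The substitution \<open>x \<mapsto> u x\<close> leaves \<open>f\<close> unchanged, because \<open>u \<equiv> 1\<close> mod the period \<open>d\<close>, but multiplies
  the sum by \<open>\<chi>(u) \<noteq> 1\<close>.
\<close>

lemma sum_dirichlet_char_periodic_eq_0:
  assumes \<chi>: "dirichlet_char q \<chi>"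
    and d: "d dvd q"
    and u: "coprime u (int q)" "[u = 1] (mod int d)" "\<chi> u \<noteq> 1"
    and f: "\<And>x y. [x = y] (mod int d) \<Longrightarrow> f x = f y"
  shows "(\<Sum>x = 1..int q. \<chi> x * f x) = 0"
proof -
  let ?S = "\<Sum>x = 1..int q. \<chi> x * f x"
  have fq: "f x = f y" if "[x = y] (mod int q)" for x y
    by (rule f, rule cong_dvd_modulus[OF that]) (use d in simp)
  have "?S = (\<Sum>x = 1..int q. \<chi> (u * x) * f (u * x))"
    by (intro sum_residues_mult[symmetric] dirichlet_char_pos[OF \<chi>] u(1)
        arg_cong2[of _ _ _ _ "(*)"] dirichlet_char_cong[OF \<chi>] fq)
  also have "\<dots> = (\<Sum>x = 1..int q. \<chi> u * (\<chi> x * f x))"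
  proof (rule sum.cong[OF refl])
    fix x
    have "[u * x = x] (mod int d)"
      using cong_scalar_right[OF u(2), of x] by simp
    then have "f (u * x) = f x"
      by (rule f)
    then show "\<chi> (u * x) * f (u * x) = \<chi> u * (\<chi> x * f x)"
      by (simp add: dirichlet_char_mult[OF \<chi>])
  qed
  also have "\<dots> = \<chi> u * ?S"
    by (simp add: sum_distrib_left)
  finally have "(1 - \<chi> u) * ?S = 0"
    by (simp add: left_diff_distrib)
  then show ?thesis
    using u(3) by simp
qed

text \<open>
  If \<open>\<chi>\<close> is trivial on all units \<open>u \<equiv> 1\<close> mod \<open>p\<^sup>j\<close>, then its value at a unit depends only on the
  residue mod \<open>p\<^sup>j\<close>, since congruent units \<open>x\<close>, \<open>y\<close> have a quotient \<open>u\<close> of this kind. For \<open>j > 0\<close>,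
  being prime to \<open>p\<^sup>j\<close> and to \<open>p\<^sup>m\<close> is the same thing, so \<open>\<chi>\<close> itself is a character mod \<open>p\<^sup>j\<close>.
\<close>

lemma not_induced_by_prime_power_witness:
  assumes p: "prime p" and j: "j \<le> m" and m: "m > 0"
    and \<chi>: "dirichlet_char (p ^ m) \<chi>"
    and not_induced: "\<nexists>\<psi>. induced_by (p ^ m) \<chi> (p ^ j) \<psi>"
  obtains u where "coprime u (int (p ^ m))" "[u = 1] (mod int (p ^ j))" "\<chi> u \<noteq> 1"
proof -
  have "\<exists>u. coprime u (int (p ^ m)) \<and> [u = 1] (mod int (p ^ j)) \<and> \<chi> u \<noteq> 1"
  proof (rule ccontr)
    assume "\<not> ?thesis"
    then have triv: "\<chi> u = 1" if "coprime u (int (p ^ m))" "[u = 1] (mod int (p ^ j))" for u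
      using that by blast
    have dvd: "p ^ j dvd p ^ m"
      using j by (rule le_imp_power_dvd)
    have "\<exists>\<psi>. induced_by (p ^ m) \<chi> (p ^ j) \<psi>"
    \<comment> \<open>Mod \<open>p\<^sup>0 = 1\<close> every integer is a unit, so here the inducing character is not \<open>\<chi>\<close> itself.\<close>
    proof (cases "j = 0")
      case True
      then have "induced_by (p ^ m) \<chi> (p ^ j) (\<lambda>_. 1)"
        using \<chi> triv by (auto simp: induced_by_def dirichlet_char_def)
      then show ?thesis by blast
    next
      case False
      have coprime_iff: "coprime x (int (p ^ j)) \<longleftrightarrow> coprime x (int (p ^ m))" for x
        using False m by (simp add: coprime_power_right_iff)
      have "\<chi> x = \<chi> y" if xy: "[x = y] (mod int (p ^ j))" for x y
      proof (cases "coprime y (int (p ^ m))")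
        case y: True
        have x: "coprime x (int (p ^ m))"
          using xy y coprime_iff cong_imp_coprime cong_sym by blast
        obtain z where z: "[y * z = 1] (mod int (p ^ m))"
          using cong_solve_coprime_int[OF y] by auto
        then have cz: "coprime z (int (p ^ m))"
          by (metis cong_imp_coprime cong_sym coprime_1_left coprime_mult_left_iff)
        have "[x * z = y * z] (mod int (p ^ j))"
          using xy by (rule cong_scalar_right)
        moreover have "[y * z = 1] (mod int (p ^ j))"
          using z dvd by (meson cong_dvd_modulus of_nat_dvd_iff)
        ultimately have "\<chi> (x * z) = 1"
          using x cz by (intro triv) (auto intro: cong_trans)
        moreover have "\<chi> (y * z) = 1"
          using dirichlet_char_cong[OF \<chi> z] dirichlet_char_1[OF \<chi>] by simp
        ultimately show ?thesis
          by (metis dirichlet_char_mult[OF \<chi>] mult_cancel_right mult_zero_right zero_neq_one)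
      next
        case False
        moreover have "\<not> coprime x (int (p ^ m))"
          using xy False coprime_iff cong_imp_coprime by blast
        ultimately show ?thesis
          using dirichlet_char_eq_0_iff[OF \<chi>] by metis
      qed
      then have "dirichlet_char (p ^ j) \<chi>"
        unfolding dirichlet_char_def coprime_iff
        using p dirichlet_char_mult[OF \<chi>] dirichlet_char_eq_0_iff[OF \<chi>] by (simp add: prime_gt_0_nat)
      then show ?thesis
        using dvd \<chi> unfolding induced_by_def by blast
    qed
    with not_induced show False ..
  qed
  then show ?thesis
    using that by blast
qed

section \<open>Gauss sums\<close>

lemma gauss_sum_twist:
  assumes \<chi>: "dirichlet_char q \<chi>" and t: "coprime t (int q)"
  shows "(\<Sum>x = 1..int q. \<chi> x * e_mod q (t * x)) = cnj (\<chi> t) * gauss_sum \<chi> q"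
proof -
  have "gauss_sum \<chi> q = (\<Sum>x = 1..int q. \<chi> (t * x) * e_mod q (t * x))"
    unfolding gauss_sum_def
    by (intro sum_residues_mult[symmetric] dirichlet_char_pos[OF \<chi>] t
        arg_cong2[of _ _ _ _ "(*)"] dirichlet_char_cong[OF \<chi>] e_mod_cong)
  also have "\<dots> = \<chi> t * (\<Sum>x = 1..int q. \<chi> x * e_mod q (t * x))"
    by (simp add: dirichlet_char_mult[OF \<chi>] sum_distrib_left mult.assoc)
  finally show ?thesis
    using dirichlet_char_mult_cnj[OF \<chi> t] by (simp add: mult_ac)
qed

text \<open>
  For \<open>t\<close> divisible by \<open>p\<close> the right-hand side is 0. On the left the exponential then has period
  \<open>p\<^sup>m\<^sup>-\<^sup>1\<close>, and \<open>\<chi>\<close>, being primitive, is not induced from that modulus, so the sum cancels.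
\<close>

lemma gauss_sum_twist_primitive:
  assumes p: "prime p" and m: "m > 0" and \<chi>: "primitive_char (p ^ m) \<chi>"
  shows "(\<Sum>x = 1..int (p ^ m). \<chi> x * e_mod (p ^ m) (t * x)) = cnj (\<chi> t) * gauss_sum \<chi> (p ^ m)"
proof (cases "coprime t (int (p ^ m))")
  case True
  then show ?thesis
    using \<chi> by (intro gauss_sum_twist) (auto simp: primitive_char_def)
next
  case False
  have char: "dirichlet_char (p ^ m) \<chi>"
    using \<chi> by (simp add: primitive_char_def)
  have pm: "p ^ m = p * p ^ (m - 1)"
    using m by (cases m) auto
  have "\<not> coprime t (int p)"
    using False m by (simp add: coprime_power_right_iff)
  then have "int p dvd t"
    using p by (metis coprime_commute prime_imp_coprime prime_nat_int_transfer)
  then obtain s where s: "t = int p * s" ..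
  have "p ^ (m - 1) < p ^ m"
    using m prime_gt_1_nat[OF p] by (intro power_strict_increasing) simp_all
  then have "\<nexists>\<psi>. induced_by (p ^ m) \<chi> (p ^ (m - 1)) \<psi>"
    using \<chi> unfolding primitive_char_def by blast
  then obtain u where u: "coprime u (int (p ^ m))" "[u = 1] (mod int (p ^ (m - 1)))" "\<chi> u \<noteq> 1"
    using not_induced_by_prime_power_witness[OF p _ m char, of "m - 1"] by auto
  have e: "e_mod (p ^ m) (t * x) = e_mod (p ^ (m - 1)) (s * x)" for x
    using e_mod_mult_cancel[of p "p ^ (m - 1)" "s * x"] p
    by (simp add: pm s mult.assoc prime_gt_0_nat)
  have "(\<Sum>x = 1..int (p ^ m). \<chi> x * e_mod (p ^ m) (t * x)) = 0"
    unfolding e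
    by (rule sum_dirichlet_char_periodic_eq_0[OF char _ u])
      (auto intro!: e_mod_cong cong_scalar_left simp: pm p prime_gt_0_nat)
  moreover have "\<chi> t = 0"
    using False dirichlet_char_eq_0_iff[OF char] by blast
  ultimately show ?thesis
    by simp
qed

text \<open>
  Expanding only the conjugate factor, each term absorbs the other factor into a twisted Gauss sum.
  This is legitimate for every \<open>y\<close>, not just for units, because \<open>\<chi>\<close> is primitive. Summing over the
  complete range of \<open>y\<close> first, orthogonality leaves only \<open>x = 1\<close>.
\<close>

lemma gauss_sum_mult_cnj_primitive:
  assumes p: "prime p" and m: "m > 0" and \<chi>: "primitive_char (p ^ m) \<chi>"
  shows "gauss_sum \<chi> (p ^ m) * cnj (gauss_sum \<chi> (p ^ m)) = of_nat (p ^ m)"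
proof -
  define q where "q = p ^ m"
  have char: "dirichlet_char q \<chi>"
    using \<chi> by (simp add: primitive_char_def q_def)
  have q: "q > 0"
    by (rule dirichlet_char_pos[OF char])
  have "gauss_sum \<chi> q * cnj (gauss_sum \<chi> q) =
      (\<Sum>y = 1..int q. (cnj (\<chi> y) * gauss_sum \<chi> q) * e_mod q (- y))"
    unfolding gauss_sum_def[of \<chi> q, THEN arg_cong[of _ _ cnj]]
    by (simp add: cnj_e_mod sum_distrib_left mult_ac)
  also have "\<dots> = (\<Sum>y = 1..int q. (\<Sum>x = 1..int q. \<chi> x * e_mod q (y * x)) * e_mod q (- y))"
    unfolding q_def gauss_sum_twist_primitive[OF assms] ..
  also have "\<dots> = (\<Sum>y = 1..int q. \<Sum>x = 1..int q. \<chi> x * e_mod q (y * (x - 1)))"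
    by (simp add: sum_distrib_right mult.assoc e_mod_add[symmetric] right_diff_distrib)
  also have "\<dots> = (\<Sum>x = 1..int q. \<chi> x * (\<Sum>y = 1..int q. e_mod q (y * (x - 1))))"
    by (subst sum.swap) (simp add: sum_distrib_left)
  also have "\<dots> = (\<Sum>x = 1..int q. if x = 1 then of_nat q else 0)"
  proof (rule sum.cong[OF refl])
    fix x assume x: "x \<in> {1..int q}"
    have "int q dvd x - 1 \<longleftrightarrow> x = 1"
      using x zdvd_not_zless[of "x - 1" "int q"] by (cases "x = 1") auto
    then show "\<chi> x * (\<Sum>y = 1..int q. e_mod q (y * (x - 1))) = (if x = 1 then of_nat q else 0)"
      using q by (simp add: sum_e_mod dirichlet_char_1[OF char])
  qed
  also have "\<dots> = of_nat q"
    using q by simp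
  finally show ?thesis
    by (simp add: q_def)
qed

section \<open>Jacobi sums\<close>

text \<open>
  By orthogonality the sum of \<open>e_mod q (t * (x\<^sub>1 + \<cdots> + x\<^sub>k - B))\<close> over \<open>t\<close> is \<open>q\<close> times the
  indicator of the defining congruence; for fixed \<open>t\<close> the sum over all tuples then factors.
\<close>

lemma jacobi_sum_fourier:
  assumes q: "q > 0"
  shows "of_nat q * jacobi_sum B \<chi> k q =
    (\<Sum>t = 1..int q. e_mod q (- (t * B)) * (\<Prod>i = 1..k. \<Sum>x = 1..int q. \<chi> i x * e_mod q (t * x)))"
proof -
  let ?P = "{1..k} \<rightarrow>\<^sub>E {1..int q}"
  have fin: "finite ?P"
    by (intro finite_PiE) auto
  have "of_nat q * jacobi_sum B \<chi> k q =
      (\<Sum>x\<in>?P. if int q dvd (\<Sum>i = 1..k. x i) - B then of_nat q * (\<Prod>i = 1..k. \<chi> i (x i)) else 0)"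
    unfolding jacobi_sum_def cong_iff_dvd_diff sum.inter_filter[OF fin]
    by (simp add: sum_distrib_left if_distrib cong: if_cong)
  also have "\<dots> = (\<Sum>x\<in>?P. (\<Sum>t = 1..int q. e_mod q (t * ((\<Sum>i = 1..k. x i) - B))) * (\<Prod>i = 1..k. \<chi> i (x i)))"
    by (intro sum.cong refl) (simp add: sum_e_mod[OF q])
  also have "\<dots> = (\<Sum>t = 1..int q. \<Sum>x\<in>?P. e_mod q (t * ((\<Sum>i = 1..k. x i) - B)) * (\<Prod>i = 1..k. \<chi> i (x i)))"
    by (subst sum.swap) (simp add: sum_distrib_right)
  also have "\<dots> = (\<Sum>t = 1..int q. e_mod q (- (t * B)) *
      (\<Sum>x\<in>?P. \<Prod>i = 1..k. \<chi> i (x i) * e_mod q (t * x i)))"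
  proof (rule sum.cong[OF refl])
    fix t
    have "e_mod q (t * ((\<Sum>i = 1..k. x i) - B)) =
        e_mod q (- (t * B)) * (\<Prod>i = 1..k. e_mod q (t * x i))" for x
      by (simp add: e_mod_sum[symmetric] e_mod_add[symmetric] sum_distrib_left right_diff_distrib)
    then show "(\<Sum>x\<in>?P. e_mod q (t * ((\<Sum>i = 1..k. x i) - B)) * (\<Prod>i = 1..k. \<chi> i (x i))) =
        e_mod q (- (t * B)) * (\<Sum>x\<in>?P. \<Prod>i = 1..k. \<chi> i (x i) * e_mod q (t * x i))"
      by (simp add: sum_distrib_left prod.distrib mult_ac)
  qed
  also have "\<dots> = (\<Sum>t = 1..int q. e_mod q (- (t * B)) *
      (\<Prod>i = 1..k. \<Sum>x = 1..int q. \<chi> i x * e_mod q (t * x)))"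
    by (simp add: prod_sum_PiE)
  finally show ?thesis .
qed

text \<open>
  Replacing every twisted sum by a conjugate character value times a Gauss sum is valid for all \<open>t\<close>
  at once: when \<open>t\<close> is not a unit, both sides vanish through the factor of the primitive
  \<open>\<chi>\<^sub>k\<close>. The absolute value of \<open>gauss_sum (\<chi> k)\<close> then absorbs the factor \<open>p\<^sup>m\<close> from the Fourier expansion.
\<close>

lemma jacobi_sum_eq_gauss_sums:
  assumes p: "prime p" and m: "m > 0" and k: "k \<ge> 1"
    and char: "\<And>i. i \<in> {1..k} \<Longrightarrow> dirichlet_char (p ^ m) (\<chi> i)"
    and prim: "primitive_char (p ^ m) (\<chi> k)"
  shows "jacobi_sum B \<chi> k (p ^ m) =
    cnj (\<Sum>t = 1..int (p ^ m). char_prod \<chi> k t * e_mod (p ^ m) (t * B))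
      / cnj (gauss_sum (\<chi> k) (p ^ m)) * (\<Prod>i = 1..k - 1. gauss_sum (\<chi> i) (p ^ m))"
proof -
  define q where "q = p ^ m"
  let ?S = "\<Sum>t = 1..int q. char_prod \<chi> k t * e_mod q (t * B)"
  let ?G = "\<lambda>i. gauss_sum (\<chi> i) q"
  have q: "q > 0"
    using p by (simp add: q_def prime_gt_0_nat)
  have split_last: "(\<Prod>i = 1..k. f i) = (\<Prod>i = 1..k - 1. f i) * f k" for f :: "nat \<Rightarrow> complex"
    using k by (cases k) auto
  have twist: "(\<Prod>i = 1..k. \<Sum>x = 1..int q. \<chi> i x * e_mod q (t * x)) =
      cnj (char_prod \<chi> k t) * (\<Prod>i = 1..k. ?G i)" for t
  proof (cases "coprime t (int q)")
    case True
    then have "(\<Sum>x = 1..int q. \<chi> i x * e_mod q (t * x)) = cnj (\<chi> i t) * ?G i" if "i \<in> {1..k}" for i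
      using char[OF that] by (intro gauss_sum_twist) (simp_all add: q_def)
    then show ?thesis
      by (simp add: char_prod_def prod.distrib)
  next
    case False
    have "\<chi> k t = 0"
      using False char[of k] k dirichlet_char_eq_0_iff unfolding q_def by fastforce
    moreover have "(\<Sum>x = 1..int q. \<chi> k x * e_mod q (t * x)) = cnj (\<chi> k t) * ?G k"
      unfolding q_def by (rule gauss_sum_twist_primitive[OF p m prim])
    ultimately show ?thesis
      unfolding split_last char_prod_def by simp
  qed
  have norm: "?G k * cnj (?G k) = of_nat q"
    unfolding q_def by (rule gauss_sum_mult_cnj_primitive[OF p m prim])
  then have "cnj (?G k) \<noteq> 0"
    using q by auto
  have "of_nat q * jacobi_sum B \<chi> k q = cnj ?S * (\<Prod>i = 1..k. ?G i)"
    unfolding jacobi_sum_fourier[OF q] twist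
    by (simp add: sum_distrib_left cnj_e_mod mult_ac)
  also have "\<dots> = of_nat q * (cnj ?S / cnj (?G k) * (\<Prod>i = 1..k - 1. ?G i))"
    unfolding norm[symmetric] split_last using \<open>cnj (?G k) \<noteq> 0\<close> by (simp add: field_simps)
  finally show ?thesis
    using q unfolding q_def[symmetric] by (subst (asm) mult_cancel_left) simp
qed

theorem theorem2p2:
  fixes p m n k :: nat and \<chi> :: "nat \<Rightarrow> int \<Rightarrow> complex"
  assumes "prime p"
    and "n < m"
    and "k \<ge> 1"
    and "\<And>i. i \<in> {1..k} \<Longrightarrow> dirichlet_char (p ^ m) (\<chi> i)"
    and "primitive_char (p ^ m) (\<chi> k)"
  shows "(\<forall>\<psi>. induced_by (p ^ m) (char_prod \<chi> k) (p ^ (m - n)) \<psi> \<longrightarrow>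
             jacobi_sum (int (p ^ n)) \<chi> k (p ^ m) =
               of_nat (p ^ n)
                 * (cnj (gauss_sum \<psi> (p ^ (m - n))) / cnj (gauss_sum (\<chi> k) (p ^ m)))
                 * (\<Prod>i = 1..k - 1. gauss_sum (\<chi> i) (p ^ m))) \<and>
         ((\<nexists>\<psi>. induced_by (p ^ m) (char_prod \<chi> k) (p ^ (m - n)) \<psi>) \<longrightarrow>
             jacobi_sum (int (p ^ n)) \<chi> k (p ^ m) = 0)"
proof -
  have m: "m > 0"
    using \<open>n < m\<close> by simp
  have pm: "p ^ m = p ^ n * p ^ (m - n)"
    using \<open>n < m\<close> by (simp add: power_add[symmetric])
  have pos: "p ^ l > 0" for l
    using \<open>prime p\<close> by (simp add: prime_gt_0_nat)
  let ?\<psi> = "char_prod \<chi> k"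
  let ?S = "\<Sum>t = 1..int (p ^ m). ?\<psi> t * e_mod (p ^ (m - n)) t"
  have e: "e_mod (p ^ m) (t * int (p ^ n)) = e_mod (p ^ (m - n)) t" for t
    unfolding pm using e_mod_mult_cancel[OF pos, of n "p ^ (m - n)" t] by (simp add: mult.commute)
  have J: "jacobi_sum (int (p ^ n)) \<chi> k (p ^ m) =
      cnj ?S / cnj (gauss_sum (\<chi> k) (p ^ m)) * (\<Prod>i = 1..k - 1. gauss_sum (\<chi> i) (p ^ m))"
    unfolding e[symmetric] using assms m by (intro jacobi_sum_eq_gauss_sums) simp_all
  have char: "dirichlet_char (p ^ m) ?\<psi>"
    using assms(3,4) by (rule dirichlet_char_char_prod)
  have "?S = of_nat (p ^ n) * gauss_sum \<psi> (p ^ (m - n))"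
    if ind: "induced_by (p ^ m) ?\<psi> (p ^ (m - n)) \<psi>" for \<psi>
  proof -
    have \<psi>: "dirichlet_char (p ^ (m - n)) \<psi>"
      using ind by (simp add: induced_by_def)
    have coprime_iff: "coprime x (int (p ^ (m - n))) \<longleftrightarrow> coprime x (int (p ^ m))" for x
      using \<open>n < m\<close> m by (simp add: coprime_power_right_iff)
    have "?\<psi> x = \<psi> x" for x
      using ind dirichlet_char_eq_0_iff[OF char, of x] dirichlet_char_eq_0_iff[OF \<psi>, of x]
      unfolding induced_by_def coprime_iff by metis
    then have "?S = (\<Sum>t = 1..int (p ^ n * p ^ (m - n)). \<psi> t * e_mod (p ^ (m - n)) t)"
      by (simp add: pm)
    also have "\<dots> = of_nat (p ^ n) * gauss_sum \<psi> (p ^ (m - n))"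
      unfolding gauss_sum_def
      by (intro sum_residues_multiple pos arg_cong2[of _ _ _ _ "(*)"]
          dirichlet_char_cong[OF \<psi>] e_mod_cong)
    finally show ?thesis .
  qed
  moreover have "?S = 0" if not_induced: "\<nexists>\<psi>. induced_by (p ^ m) ?\<psi> (p ^ (m - n)) \<psi>"
  proof -
    obtain u where u: "coprime u (int (p ^ m))" "[u = 1] (mod int (p ^ (m - n)))" "?\<psi> u \<noteq> 1"
      using not_induced_by_prime_power_witness[OF \<open>prime p\<close> diff_le_self m char not_induced] by blast
    have "p ^ (m - n) dvd p ^ m"
      by (simp add: pm)
    then show ?thesis
      by (rule sum_dirichlet_char_periodic_eq_0[OF char _ u e_mod_cong[OF pos]])
  qed
  ultimately show ?thesis
    unfolding J by auto
qed

end
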